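(* Let $\mathfrak{g}=\{(a_{ij})\in\mathbb{C}^{3\times3}\mid a_{ij}=0\text{ for }i\ge j\}$, $G=\exp(\mathfrak{g})$, and $\mathfrak{J}=\{v:\mathbb{R}\to\mathfrak{g}\text{ smooth}\}$. Then for each $u\in\mathfrak{J}$, $$\frac{d_G}{d_Gx}\Big(\int_0^x\exp(u(t))\,d_Gt\Big)=\int_0^x\Big(\frac{d_G}{d_Gt}\exp(u(t))\Big)d_Gt=\exp(u(x)).$$
   Context: $\exp$ is the matrix exponential, bijective from $\mathfrak{g}$ onto $G$; real powers in $G$ are $\exp(X)^r=\exp(rX)$, $X\in\mathfrak{g}$, $r\in\mathbb{R}$. Products $\prod_{k=1}^n g_k$ are ordered as $g_1g_2\cdots g_n$. $\mathbb{R}$-integral: for a map $a:\mathbb{R}\to G$ and a partition $P$: $\ell=t_0\le\cdots\le t_n=m$ with $\triangle_i=t_i-t_{i-1}$ and $|P|=\max_i\triangle_i$, $$\int_\ell^m a(t)\,d_Gt:=\lim_{|P|\to0}\prod_{k=1}^n\big(a(\xi_{n+1-k})\big)^{\triangle_{n+1-k}},$$ provided the limit uniquely exists for arbitrary partitions and arbitrary $\xi_k\in[t_{k-1},t_k]$. For $x<0$, $\int_0^x a(t)\,d_Gt$ means $\big(\int_x^0 a(t)\,d_Gt\big)^{-1}$. $\mathbb{R}$-derivative: $\frac{d_G}{d_Gx}(a(x)):=\lim_{\lambda\to0}\big(a(x+\lambda)a(x)^{-1}\big)^{1/\lambda}$, provided the limit uniquely exists.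
   Formalization: The second equality fails for constant nonzero u; it is replaced, for every u, by: the integral from 0 to x of the derivative of exp(u(t)) equals exp(u(x)) exp(u(0))^{-1}. The printed chain of equalities is asserted exactly when u(0)=0. *)

theory Defs
  imports "HOL-Analysis.Analysis"
begin

text \<open>The product \<open>*\<close> on this matrix type is componentwise, and the type is not an instance of the
  classes required by the library's \<open>exp\<close>.\<close>

type_synonym cmat3 = "complex ^ 3 ^ 3"

definition mpow :: "'a::semiring_1 ^ 'n ^ 'n \<Rightarrow> nat \<Rightarrow> 'a ^ 'n ^ 'n" where
  "mpow A n = ((\<lambda>B. A ** B) ^^ n) (mat 1)"

definition mexp :: "complex ^ 'n ^ 'n \<Rightarrow> complex ^ 'n ^ 'n" where
  "mexp A = (\<Sum>n. (1 / fact n) *\<^sub>R mpow A n)"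

text \<open>Rows and columns are numbered 1, 2, 3 as natural numbers, because the linear order on the
  numeral type \<open>3\<close> has \<open>3 = 0\<close> as its least element.\<close>

definition lie_g :: "cmat3 set" where
  "lie_g = {A. \<forall>i\<in>{1..3::nat}. \<forall>j\<in>{1..3::nat}. i \<ge> j \<longrightarrow> A $ of_nat i $ of_nat j = 0}"

definition grp_G :: "cmat3 set" where
  "grp_G = mexp ` lie_g"

definition smooth_curve :: "(real \<Rightarrow> 'a::real_normed_vector) \<Rightarrow> bool" where
  "smooth_curve u \<longleftrightarrow>
    (\<forall>n t. ((\<lambda>f s. vector_derivative f (at s)) ^^ n) u differentiable at t)"

definition space_J :: "(real \<Rightarrow> cmat3) set" where
  "space_J = {v. smooth_curve v \<and> range v \<subseteq> lie_g}"

text \<open>The real power \<open>exp (X)\<^sup>r = exp (r X)\<close> for \<open>X\<close> in \<^const>\<open>lie_g\<close>; it is meaningful on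
  \<^const>\<open>grp_G\<close> only.\<close>

definition gpow :: "cmat3 \<Rightarrow> real \<Rightarrow> cmat3" where
  "gpow a r = mexp (r *\<^sub>R the_inv_into lie_g mexp a)"

primrec mprod :: "(nat \<Rightarrow> 'a::semiring_1 ^ 'n ^ 'n) \<Rightarrow> nat \<Rightarrow> 'a ^ 'n ^ 'n" where
  "mprod g 0 = mat 1"
| "mprod g (Suc n) = mprod g n ** g (Suc n)"

text \<open>Tagged partitions \<open>l = t 0 \<le> \<dots> \<le> t n = m\<close> with tags \<open>\<xi> k \<in> [t (k - 1), t k]\<close>; the values
  of \<open>t\<close> and \<open>\<xi>\<close> at other indices are irrelevant.\<close>

definition tagged_partition ::
  "real \<Rightarrow> real \<Rightarrow> nat \<Rightarrow> (nat \<Rightarrow> real) \<Rightarrow> (nat \<Rightarrow> real) \<Rightarrow> bool" where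
  "tagged_partition l m n t \<xi> \<longleftrightarrow>
    n \<ge> 1 \<and> t 0 = l \<and> t n = m \<and>
    (\<forall>k\<in>{1..n}. t (k - 1) \<le> t k \<and> \<xi> k \<in> {t (k - 1)..t k})"

definition mesh :: "nat \<Rightarrow> (nat \<Rightarrow> real) \<Rightarrow> real" where
  "mesh n t = Max ((\<lambda>k. t k - t (k - 1)) ` {1..n})"

definition riemann_product ::
  "(real \<Rightarrow> cmat3) \<Rightarrow> nat \<Rightarrow> (nat \<Rightarrow> real) \<Rightarrow> (nat \<Rightarrow> real) \<Rightarrow> cmat3" where
  "riemann_product a n t \<xi> =
    mprod (\<lambda>k. gpow (a (\<xi> (n + 1 - k))) (t (n + 1 - k) - t (n + 1 - k - 1))) n"

text \<open>The integral for \<open>l \<le> m\<close>, as a limit in \<^const>\<open>grp_G\<close>.\<close>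

definition has_G_integral :: "(real \<Rightarrow> cmat3) \<Rightarrow> cmat3 \<Rightarrow> real \<Rightarrow> real \<Rightarrow> bool" where
  "has_G_integral a I l m \<longleftrightarrow>
    range a \<subseteq> grp_G \<and> I \<in> grp_G \<and>
    (\<forall>\<epsilon>>0. \<exists>\<delta>>0. \<forall>n t \<xi>. tagged_partition l m n t \<xi> \<and> mesh n t < \<delta> \<longrightarrow>
      dist (riemann_product a n t \<xi>) I < \<epsilon>)"

definition G_integrable :: "(real \<Rightarrow> cmat3) \<Rightarrow> real \<Rightarrow> real \<Rightarrow> bool" where
  "G_integrable a l m \<longleftrightarrow> (\<exists>!I. has_G_integral a I (min l m) (max l m))"

definition G_integral :: "real \<Rightarrow> real \<Rightarrow> (real \<Rightarrow> cmat3) \<Rightarrow> cmat3" where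
  "G_integral l m a =
    (if l \<le> m then THE I. has_G_integral a I l m
     else matrix_inv (THE I. has_G_integral a I m l))"

definition has_G_derivative :: "(real \<Rightarrow> cmat3) \<Rightarrow> cmat3 \<Rightarrow> real \<Rightarrow> bool" where
  "has_G_derivative a D x \<longleftrightarrow>
    range a \<subseteq> grp_G \<and> D \<in> grp_G \<and>
    ((\<lambda>h. gpow (a (x + h) ** matrix_inv (a x)) (1 / h)) \<longlongrightarrow> D) (at 0)"

definition G_differentiable :: "(real \<Rightarrow> cmat3) \<Rightarrow> real \<Rightarrow> bool" where
  "G_differentiable a x \<longleftrightarrow> (\<exists>!D. has_G_derivative a D x)"

definition G_deriv :: "(real \<Rightarrow> cmat3) \<Rightarrow> real \<Rightarrow> cmat3" where
  "G_deriv a x = (THE D. has_G_derivative a D x)"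

end

theory Submission
  imports Defs
begin

text \<open>
  The group is the complex Heisenberg group, and everything is explicit in the three entries above
  the diagonal. Call \<open>W\<close> a curve in the group with logarithmic derivative \<open>X\<close> when \<open>W' = X W\<close>. With
  \<open>W\<close> given by the entries \<open>(A, B, C)\<close> at the positions \<open>(12, 23, 13)\<close> and \<open>X\<close> by \<open>(p, q, r)\<close>, this
  equation reads \<open>A' = p\<close>, \<open>B' = q\<close>, \<open>C' = r + p B\<close>.

  The proposition is the fundamental theorem of calculus for this equation, in two halves. First, the
  multiplicative derivative of \<open>W\<close> is \<open>exp X\<close> (\<open>has_G_derivative_uni3\<close>), because
  \<open>W(x + h) W(x)\<^sup>-\<^sup>1\<close> is \<open>exp (h X(x) + o(h))\<close>. Second, if \<open>X\<close> is continuous, the multiplicative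
  integral of \<open>exp X\<close> over \<open>[l, m]\<close> is \<open>W(m) W(l)\<^sup>-\<^sup>1\<close> (\<open>has_G_integral_uni3\<close>), because each factor of
  a Riemann product agrees with the step \<open>W(t\<^sub>k) W(t\<^sub>k\<^sub>-\<^sub>1)\<^sup>-\<^sup>1\<close> up to \<open>o(t\<^sub>k - t\<^sub>k\<^sub>-\<^sub>1)\<close>,
  uniformly on the interval.

  For the derivative of the integral, put \<open>X = u\<close>: the equation is triangular, so a solution \<open>W\<close> with
  \<open>W(0) = 1\<close> comes from three successive antiderivatives; then \<open>W\<close> is the integral of \<open>exp u\<close> and its
  derivative is \<open>exp u\<close>. For the integral of the derivative, put \<open>W = exp u\<close>: its derivative is
  \<open>exp X\<close> with \<open>X\<close> the logarithmic derivative of \<open>exp u\<close>, and integrating recovers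
  \<open>exp u(x) exp(u(0))\<^sup>-\<^sup>1\<close>. The two results coincide when \<open>u(0) = 0\<close>.
\<close>

section \<open>Coordinates on the Heisenberg group\<close>

definition nil3 :: "complex \<Rightarrow> complex \<Rightarrow> complex \<Rightarrow> cmat3" where
  "nil3 x y z = vector [vector [0, x, z], vector [0, 0, y], vector [0, 0, 0]]"

definition uni3 :: "complex \<Rightarrow> complex \<Rightarrow> complex \<Rightarrow> cmat3" where
  "uni3 a b c = vector [vector [1, a, c], vector [0, 1, b], vector [0, 0, 1]]"

lemma uni3_mult:
  "uni3 a b c ** uni3 a' b' c' = uni3 (a + a') (b + b') (c + c' + a * b')"
  by (simp add: uni3_def vec_eq_iff forall_3 matrix_matrix_mult_def sum_3)

lemma uni3_0: "uni3 0 0 0 = mat 1"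
  by (simp add: uni3_def vec_eq_iff forall_3 mat_def)

lemma uni3_eq_iff: "uni3 a b c = uni3 a' b' c' \<longleftrightarrow> a = a' \<and> b = b' \<and> c = c'"
  by (auto simp: uni3_def vec_eq_iff forall_3)

lemma matrix_inv_uni3: "matrix_inv (uni3 a b c) = uni3 (- a) (- b) (a * b - c)"
proof -
  let ?V = "uni3 (- a) (- b) (a * b - c)"
  have V: "uni3 a b c ** ?V = mat 1" "?V ** uni3 a b c = mat 1"
    by (simp_all add: uni3_mult flip: uni3_0)
  have "V' = ?V" if "uni3 a b c ** V' = mat 1 \<and> V' ** uni3 a b c = mat 1" for V'
    using that V by (metis matrix_mul_assoc matrix_mul_lid matrix_mul_rid)
  with V show ?thesis
    unfolding matrix_inv_def by (intro some_equality) blast+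
qed

lemma lie_g_eq: "lie_g = {nil3 x y z | x y z. True}"
proof -
  have iv: "{1..3::nat} = {1, 2, 3}" by auto
  have "X \<in> lie_g \<longleftrightarrow> X = nil3 (X $ 1 $ 2) (X $ 2 $ 3) (X $ 1 $ 3)" for X
    unfolding lie_g_def iv
    by (simp add: nil3_def vec_eq_iff forall_3)
  moreover have "nil3 x y z \<in> lie_g" for x y z
    unfolding lie_g_def iv by (simp add: nil3_def)
  ultimately show ?thesis by blast
qed

text \<open>The exponential series stops after the quadratic term, since a product of three strictly upper
  triangular matrices vanishes; the square contributes only to the corner entry.\<close>

lemma mexp_nil3: "mexp (nil3 x y z) = uni3 x y (z + x * y / 2)"
proof -
  let ?X = "nil3 x y z"
  have p2: "mpow ?X (Suc (Suc 0)) = nil3 0 0 (x * y)"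
    by (simp add: mpow_def nil3_def vec_eq_iff forall_3 matrix_matrix_mult_def sum_3 mat_def)
  have p3: "mpow ?X (Suc (Suc (Suc k))) = 0" for k
  proof (induction k)
    case 0
    have "mpow ?X (Suc (Suc (Suc 0))) = ?X ** mpow ?X (Suc (Suc 0))" by (simp add: mpow_def)
    then show ?case unfolding p2
      by (simp add: nil3_def vec_eq_iff forall_3 matrix_matrix_mult_def sum_3)
  next
    case (Suc k)
    then show ?case by (simp add: mpow_def matrix_matrix_mult_def vec_eq_iff)
  qed
  have "mpow ?X n = 0" if "n \<notin> {..<3}" for n
  proof -
    have "n = Suc (Suc (Suc (n - 3)))" using that by simp
    then show ?thesis using p3 by metis
  qed
  then have "mexp ?X = (\<Sum>n<3. (1 / fact n) *\<^sub>R mpow ?X n)"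
    unfolding mexp_def by (intro suminf_finite) auto
  also have "\<dots> = mat 1 + ?X + (1 / 2) *\<^sub>R nil3 0 0 (x * y)"
    using p2 by (simp add: numeral_3_eq_3) (simp add: mpow_def)
  also have "\<dots> = uni3 x y (z + x * y / 2)"
    by (simp add: nil3_def uni3_def vec_eq_iff forall_3 mat_def scaleR_conv_of_real[where 'a = complex])
  finally show ?thesis .
qed

lemma uni3_eq_mexp: "uni3 a b c = mexp (nil3 a b (c - a * b / 2))"
  by (simp add: mexp_nil3)

lemma uni3_in_grp_G: "uni3 a b c \<in> grp_G"
  unfolding grp_G_def uni3_eq_mexp lie_g_eq by blast

text \<open>The coordinate formula for the exponential can be solved for \<open>(x, y, z)\<close>, so \<open>mexp\<close> is injective on
  the Lie algebra and the logarithm in the definition of \<open>gpow\<close> can be read off. Powers scale the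
  logarithm, whose corner entry is \<open>c - a b / 2\<close>.\<close>

lemma gpow_uni3:
  "gpow (uni3 a b c) r =
    uni3 (of_real r * a) (of_real r * b)
      (of_real r * (c - a * b / 2) + (of_real r)\<^sup>2 * (a * b) / 2)"
proof -
  have inj: "inj_on mexp lie_g"
    by (auto simp: inj_on_def lie_g_eq mexp_nil3 uni3_eq_iff)
  have "nil3 a b (c - a * b / 2) \<in> lie_g" unfolding lie_g_eq by blast
  then have "the_inv_into lie_g mexp (uni3 a b c) = nil3 a b (c - a * b / 2)"
    unfolding uni3_eq_mexp using the_inv_into_f_f[OF inj] by blast
  moreover have "r *\<^sub>R nil3 a b z = nil3 (of_real r * a) (of_real r * b) (of_real r * z)" for z
    by (simp add: nil3_def vec_eq_iff forall_3 scaleR_conv_of_real[where 'a = complex])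
  ultimately show ?thesis
    by (simp add: gpow_def mexp_nil3 power2_eq_square algebra_simps)
qed

text \<open>This bound reduces all limits in the group to limits of the three complex coordinates.\<close>

lemma dist_uni3_le:
  "dist (uni3 a b c) (uni3 a' b' c') \<le> norm (a - a') + norm (b - b') + norm (c - c')"
proof -
  have row: "norm v \<le> norm (v $ 1) + norm (v $ 2) + norm (v $ 3)" for v :: "complex ^ 3"
    unfolding norm_vec_def using L2_set_le_sum[of UNIV "\<lambda>i. norm (v $ i)"] by (simp add: sum_3)
  let ?D = "uni3 a b c - uni3 a' b' c'"
  have "norm ?D \<le> norm (?D $ 1) + norm (?D $ 2) + norm (?D $ 3)"
    unfolding norm_vec_def[of ?D] using L2_set_le_sum[of UNIV "\<lambda>i. norm (?D $ i)"] by (simp add: sum_3)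
  also have "\<dots> \<le> (norm (a - a') + norm (c - c')) + norm (b - b') + 0"
    by (intro add_mono order.trans[OF row]) (simp_all add: uni3_def)
  finally show ?thesis by (simp add: dist_norm)
qed

lemma tendsto_uni3:
  assumes "(f \<longlongrightarrow> a) F" "(g \<longlongrightarrow> b) F" "(h \<longlongrightarrow> c) F"
  shows "((\<lambda>x. uni3 (f x) (g x) (h x)) \<longlongrightarrow> uni3 a b c) F"
proof (rule metric_tendsto_imp_tendsto)
  have "((\<lambda>x. norm (f x - a) + norm (g x - b) + norm (h x - c)) \<longlongrightarrow>
      norm (a - a) + norm (b - b) + norm (c - c)) F"
    by (intro tendsto_intros assms)
  then show "((\<lambda>x. norm (f x - a) + norm (g x - b) + norm (h x - c)) \<longlongrightarrow> 0) F" by simp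
  show "\<forall>\<^sub>F x in F. dist (uni3 (f x) (g x) (h x)) (uni3 a b c)
      \<le> dist (norm (f x - a) + norm (g x - b) + norm (h x - c)) 0"
    by (simp add: dist_uni3_le)
qed

section \<open>The multiplicative derivative\<close>

lemma has_G_derivative_unique:
  assumes "has_G_derivative a D x" "has_G_derivative a E x"
  shows "D = E"
proof (rule tendsto_unique[OF at_neq_bot])
  show "((\<lambda>h. gpow (a (x + h) ** matrix_inv (a x)) (1 / h)) \<longlongrightarrow> D) (at 0)"
    using assms(1) by (simp add: has_G_derivative_def)
  show "((\<lambda>h. gpow (a (x + h) ** matrix_inv (a x)) (1 / h)) \<longlongrightarrow> E) (at 0)"
    using assms(2) by (simp add: has_G_derivative_def)
qed

lemma has_G_derivativeD:
  assumes "has_G_derivative a D x"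
  shows "G_differentiable a x" "G_deriv a x = D"
proof -
  have eq: "E = D" if "has_G_derivative a E x" for E
    using has_G_derivative_unique[OF that assms] .
  show "G_differentiable a x"
    unfolding G_differentiable_def using assms eq by (rule ex1I)
  show "G_deriv a x = D"
    unfolding G_deriv_def using assms eq by (rule the_equality)
qed


lemma has_vector_derivative_imp_quotient_tendsto:
  assumes "(f has_vector_derivative f') (at x)"
  shows "((\<lambda>h. (f (x + h) - f x) /\<^sub>R h) \<longlongrightarrow> f') (at 0)"
proof -
  have "((\<lambda>h. norm (f (x + h) - f x - h *\<^sub>R f') / norm h) \<longlongrightarrow> 0) (at 0)"
    using assms by (simp add: has_vector_derivative_def has_derivative_at)
  moreover have "\<forall>\<^sub>F h in at 0. norm (f (x + h) - f x - h *\<^sub>R f') / norm h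
      = norm ((f (x + h) - f x) /\<^sub>R h - f')"
  proof (rule eventually_at_topological[THEN iffD2], intro exI conjI ballI impI)
    fix h :: real assume "h \<noteq> 0"
    then have "(f (x + h) - f x) /\<^sub>R h - f' = (f (x + h) - f x - h *\<^sub>R f') /\<^sub>R h"
      by (simp add: scaleR_diff_right)
    then show "norm (f (x + h) - f x - h *\<^sub>R f') / norm h
        = norm ((f (x + h) - f x) /\<^sub>R h - f')"
      by (simp add: divide_inverse mult.commute)
  qed (rule open_UNIV, simp)
  ultimately have "((\<lambda>h. norm ((f (x + h) - f x) /\<^sub>R h - f')) \<longlongrightarrow> 0) (at 0)"
    by (blast intro: Lim_transform_eventually)
  then show ?thesis by (simp add: LIM_zero_cancel tendsto_norm_zero_iff)
qed

text \<open>In coordinates, the difference quotients \<open>a, b, c\<close> of the entries turn the multiplicative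
  quotient into a group element whose corner entry is
  \<open>c - a B(x) - h a b / 2 + a b / 2\<close>. The term \<open>a B(x)\<close> cancels the part \<open>p B\<close> of \<open>C'\<close>, which is why
  \<open>r\<close> and not \<open>C'\<close> is the corner entry of the logarithmic derivative.\<close>

lemma has_G_derivative_uni3:
  fixes A B C :: "real \<Rightarrow> complex"
  assumes A: "(A has_vector_derivative p) (at x)"
    and B: "(B has_vector_derivative q) (at x)"
    and C: "(C has_vector_derivative r + p * B x) (at x)"
  shows "has_G_derivative (\<lambda>t. uni3 (A t) (B t) (C t)) (mexp (nil3 p q r)) x"
proof -
  define a where "a h = (A (x + h) - A x) /\<^sub>R h" for h
  define b where "b h = (B (x + h) - B x) /\<^sub>R h" for h
  define c where "c h = (C (x + h) - C x) /\<^sub>R h" for h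
  let ?Q = "\<lambda>h. gpow (uni3 (A (x + h)) (B (x + h)) (C (x + h))
      ** matrix_inv (uni3 (A x) (B x) (C x))) (1 / h)"
  have lim: "(a \<longlongrightarrow> p) (at 0)" "(b \<longlongrightarrow> q) (at 0)"
      "(c \<longlongrightarrow> r + p * B x) (at 0)"
    unfolding a_def b_def c_def using assms
    by (auto intro: has_vector_derivative_imp_quotient_tendsto)
  have "((\<lambda>h. uni3 (a h) (b h) (c h - a h * B x - of_real h * a h * b h / 2 + a h * b h / 2))
      \<longlongrightarrow> uni3 p q (r + p * B x - p * B x - of_real 0 * p * q / 2 + p * q / 2)) (at 0)"
    by (intro tendsto_uni3 tendsto_intros lim) simp_all
  moreover have "\<forall>\<^sub>F h in at 0.
      uni3 (a h) (b h) (c h - a h * B x - of_real h * a h * b h / 2 + a h * b h / 2) = ?Q h"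
  proof (rule eventually_at_topological[THEN iffD2], intro exI conjI ballI impI)
    fix h :: real assume "h \<noteq> 0"
    then have e: "A (x + h) = A x + of_real h * a h" "B (x + h) = B x + of_real h * b h"
        "C (x + h) = C x + of_real h * c h"
      by (simp_all add: a_def b_def c_def scaleR_conv_of_real field_simps)
    show "uni3 (a h) (b h) (c h - a h * B x - of_real h * a h * b h / 2 + a h * b h / 2) = ?Q h"
      unfolding e using \<open>h \<noteq> 0\<close>
      by (simp add: matrix_inv_uni3 uni3_mult gpow_uni3 uni3_eq_iff field_simps power2_eq_square)
  qed (rule open_UNIV, simp)
  ultimately have "(?Q \<longlongrightarrow> mexp (nil3 p q r)) (at 0)"
    by (simp add: mexp_nil3 Lim_transform_eventually)
  then show ?thesis
    unfolding has_G_derivative_def by (auto simp: uni3_in_grp_G mexp_nil3)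
qed

section \<open>Tagged partitions and uniqueness of the multiplicative integral\<close>

lemma tagged_partition_mono:
  assumes "tagged_partition l m n t \<xi>" "i \<le> j" "j \<le> n"
  shows "t i \<le> t j"
  using assms(2,3)
proof (induction j rule: dec_induct)
  case (step j)
  have "t j \<le> t (Suc j)"
    using assms(1) step.prems unfolding tagged_partition_def by force
  with step show ?case by simp
qed simp

text \<open>Arbitrarily fine partitions exist, so the limit that defines the integral is not vacuous; this
  is what makes it unique. Equidistant points with right end points as tags suffice.\<close>

lemma fine_tagged_partition_exists:
  assumes "l \<le> m" "\<delta> > 0"
  shows "\<exists>n t \<xi>. tagged_partition l m n t \<xi> \<and> mesh n t < \<delta>"
proof -
  obtain n where n: "(m - l) / \<delta> < real n" using reals_Archimedean2 by blast
  with assms have n0: "n > 0" by (cases n) (auto simp: divide_less_0_iff)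
  define t where "t k = l + (m - l) * real k / real n" for k
  have step: "t k - t (k - 1) = (m - l) / n" if "k \<in> {1..n}" for k
    using that n0 by (simp add: t_def field_simps of_nat_diff)
  have nonneg: "0 \<le> (m - l) / n" using assms by simp
  have "tagged_partition l m n t t"
    unfolding tagged_partition_def
    using n0 step nonneg by (force simp: t_def)
  moreover have "mesh n t < \<delta>"
  proof -
    have "mesh n t = Max ((\<lambda>k. (m - l) / n) ` {1..n})"
      unfolding mesh_def using step by (metis (no_types, lifting) image_cong)
    also have "\<dots> = (m - l) / n" using n0 by (simp add: image_constant_conv)
    also have "\<dots> < \<delta>" using n n0 assms by (simp add: field_simps)
    finally show ?thesis .
  qed
  ultimately show ?thesis by blast
qed

lemma has_G_integralD:
  assumes "has_G_integral a I l m" "\<epsilon> > 0"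
  shows "\<exists>\<delta>>0. \<forall>n t \<xi>. tagged_partition l m n t \<xi> \<and> mesh n t < \<delta> \<longrightarrow>
    dist (riemann_product a n t \<xi>) I < \<epsilon>"
  using assms unfolding has_G_integral_def by blast

lemma has_G_integral_unique:
  assumes "l \<le> m" "has_G_integral a I l m" "has_G_integral a J l m"
  shows "I = J"
proof (rule ccontr)
  assume "I \<noteq> J"
  then have pos: "dist I J / 2 > 0" by simp
  let ?near = "\<lambda>K \<delta>. \<delta> > 0 \<and> (\<forall>n t \<xi>. tagged_partition l m n t \<xi> \<and> mesh n t < \<delta> \<longrightarrow>
      dist (riemann_product a n t \<xi>) K < dist I J / 2)"
  obtain d where d: "?near I d" using has_G_integralD[OF assms(2) pos] ..
  obtain e where e: "?near J e" using has_G_integralD[OF assms(3) pos] ..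
  obtain n t \<xi> where "tagged_partition l m n t \<xi>" "mesh n t < min d e"
    using fine_tagged_partition_exists[OF assms(1), of "min d e"] d e by fastforce
  then show False
    using d e dist_triangle_half_r[of "riemann_product a n t \<xi>" I "dist I J" J] by simp
qed

section \<open>The multiplicative integral of a logarithmic derivative\<close>

lemma mprod_Suc_left: "mprod g (Suc n) = g 1 ** mprod (\<lambda>k. g (Suc k)) n"
  by (induction n) (simp_all add: matrix_mul_assoc)

text \<open>Riemann products multiply later factors on the left, so extending a partition to the right
  multiplies on the left, as in the discretised equation \<open>W' = X W\<close>.\<close>

lemma riemann_product_Suc:
  "riemann_product a (Suc n) t \<xi> =
    gpow (a (\<xi> (Suc n))) (t (Suc n) - t n) ** riemann_product a n t \<xi>"
  unfolding riemann_product_def mprod_Suc_left by simp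

lemma increment_estimate:
  fixes F f :: "real \<Rightarrow> complex"
  assumes "\<And>s. (F has_vector_derivative f s) (at s)"
    and "x \<in> {a..b}" "\<And>s. s \<in> {a..b} \<Longrightarrow> norm (f s - f x) \<le> \<eta>"
  shows "norm (F b - F a - of_real (b - a) * f x) \<le> \<eta> * (b - a)"
  using vector_differentiable_bound_linearization[of "{a..b}" F f a b x \<eta>] assms
    has_vector_derivative_at_within[OF assms(1)]
  by (auto simp: scaleR_conv_of_real mult.commute closed_segment_eq_real_ivl)

text \<open>
  The partial Riemann products follow the solution \<open>(A, B, C)\<close> that starts at the identity, with an
  error that grows at most linearly in the length covered. In one step of length \<open>D\<close>, the entries
  \<open>A\<close> and \<open>B\<close> gain an error \<open>\<eta> D\<close> by the mean value inequality. For the corner entry there are three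
  contributions, which make up the constant \<open>1 + M\<^sup>2 + M (m - l + 1)\<close>: the mean value inequality for
  \<open>C\<close>; the quadratic term of the exponential, which is small because \<open>D \<le> \<eta>\<close>; and the product of
  \<open>D p\<close> with the distance from the current second entry to \<open>B\<close> at the tag.
  The number \<open>\<eta>\<close> bounds the mesh and the oscillation over one mesh of all functions involved.
\<close>

lemma riemann_product_estimate:
  fixes p q r A B C :: "real \<Rightarrow> complex"
  assumes part: "tagged_partition l m n t \<xi>" and "k \<le> n"
    and der: "\<And>s. (A has_vector_derivative p s) (at s)"
      "\<And>s. (B has_vector_derivative q s) (at s)"
      "\<And>s. (C has_vector_derivative r s + p s * B s) (at s)"
    and init: "A l = 0" "B l = 0" "C l = 0"
    and bound: "\<And>s. s \<in> {l..m} \<Longrightarrow> norm (p s) \<le> M" "\<And>s. s \<in> {l..m} \<Longrightarrow> norm (q s) \<le> M"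
    and fine: "mesh n t \<le> \<eta>"
    and osc: "\<And>f s s'. f \<in> {p, q, B, \<lambda>s. r s + p s * B s} \<Longrightarrow> s \<in> {l..m} \<Longrightarrow> s' \<in> {l..m} \<Longrightarrow>
      \<bar>s - s'\<bar> \<le> mesh n t \<Longrightarrow> norm (f s - f s') \<le> \<eta>"
  shows "\<exists>\<alpha> \<beta> \<gamma>. riemann_product (\<lambda>s. mexp (nil3 (p s) (q s) (r s))) k t \<xi> = uni3 \<alpha> \<beta> \<gamma>
    \<and> norm (\<alpha> - A (t k)) \<le> \<eta> * (t k - l) \<and> norm (\<beta> - B (t k)) \<le> \<eta> * (t k - l)
    \<and> norm (\<gamma> - C (t k)) \<le> (1 + M\<^sup>2 + M * (m - l + 1)) * \<eta> * (t k - l)"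
  using \<open>k \<le> n\<close>
proof (induction k)
  case 0
  have "t 0 = l" using part by (simp add: tagged_partition_def)
  then show ?case
    using init by (intro exI[of _ 0]) (simp add: riemann_product_def uni3_0)
next
  case (Suc k)
  let ?a = "\<lambda>s. mexp (nil3 (p s) (q s) (r s))"
  let ?K = "1 + M\<^sup>2 + M * (m - l + 1)"
  obtain \<alpha> \<beta> \<gamma> where prod: "riemann_product ?a k t \<xi> = uni3 \<alpha> \<beta> \<gamma>"
    and est: "norm (\<alpha> - A (t k)) \<le> \<eta> * (t k - l)" "norm (\<beta> - B (t k)) \<le> \<eta> * (t k - l)"
      "norm (\<gamma> - C (t k)) \<le> ?K * \<eta> * (t k - l)"
    using Suc by auto
  define D where "D = t (Suc k) - t k"
  define x where "x = \<xi> (Suc k)"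
  have x: "x \<in> {t k..t (Suc k)}"
    using part Suc.prems unfolding tagged_partition_def x_def by force
  have "t 0 = l" "t n = m" using part by (auto simp: tagged_partition_def)
  then have lm: "l \<le> t k" "t (Suc k) \<le> m"
    using tagged_partition_mono[OF part, of 0 k] tagged_partition_mono[OF part, of "Suc k" n] Suc.prems
    by auto
  have D: "0 \<le> D" "D \<le> mesh n t"
  proof -
    show "0 \<le> D" using x by (simp add: D_def)
    have "D \<in> (\<lambda>k. t k - t (k - 1)) ` {1..n}"
      using Suc.prems by (intro image_eqI[of _ _ "Suc k"]) (simp_all add: D_def)
    then show "D \<le> mesh n t" unfolding mesh_def by (intro Max_ge) simp_all
  qed
  have xlm: "x \<in> {l..m}" using x lm by simp
  have M: "0 \<le> M" using order.trans[OF norm_ge_zero bound(1)[OF xlm]] .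
  have \<eta>: "0 \<le> \<eta>" using D fine by simp
  have local: "norm (f s - f s') \<le> \<eta>"
    if "f \<in> {p, q, B, \<lambda>s. r s + p s * B s}" "s \<in> {t k..t (Suc k)}" "s' \<in> {t k..t (Suc k)}" for f s s'
    using that lm D by (intro osc) (auto simp: D_def)
  have inc: "norm (A (t (Suc k)) - A (t k) - of_real D * p x) \<le> \<eta> * D"
    "norm (B (t (Suc k)) - B (t k) - of_real D * q x) \<le> \<eta> * D"
    "norm (C (t (Suc k)) - C (t k) - of_real D * (r x + p x * B x)) \<le> \<eta> * D"
    unfolding D_def
    using increment_estimate[OF der(1) x, of \<eta>] increment_estimate[OF der(2) x, of \<eta>]
      increment_estimate[OF der(3) x, of \<eta>] local[of _ _ x] x by auto
  let ?\<alpha> = "of_real D * p x + \<alpha>" and ?\<beta> = "of_real D * q x + \<beta>"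
  let ?\<gamma> = "of_real D * r x + (of_real D)\<^sup>2 * (p x * q x) / 2 + \<gamma> + of_real D * p x * \<beta>"
  have "riemann_product ?a (Suc k) t \<xi> = uni3 ?\<alpha> ?\<beta> ?\<gamma>"
    unfolding riemann_product_Suc prod by (simp add: gpow_uni3 mexp_nil3 uni3_mult D_def x_def)
  moreover have "norm (?\<alpha> - A (t (Suc k))) \<le> \<eta> * (t (Suc k) - l)"
  proof -
    have "?\<alpha> - A (t (Suc k)) = (\<alpha> - A (t k)) - (A (t (Suc k)) - A (t k) - of_real D * p x)" by simp
    also have "norm \<dots> \<le> \<eta> * (t k - l) + \<eta> * D"
      using est(1) inc(1) by (rule norm_triangle_le_diff[OF add_mono])
    finally show ?thesis by (simp add: D_def algebra_simps)
  qed
  moreover have "norm (?\<beta> - B (t (Suc k))) \<le> \<eta> * (t (Suc k) - l)"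
  proof -
    have "?\<beta> - B (t (Suc k)) = (\<beta> - B (t k)) - (B (t (Suc k)) - B (t k) - of_real D * q x)" by simp
    also have "norm \<dots> \<le> \<eta> * (t k - l) + \<eta> * D"
      using est(2) inc(2) by (rule norm_triangle_le_diff[OF add_mono])
    finally show ?thesis by (simp add: D_def algebra_simps)
  qed
  moreover have "norm (?\<gamma> - C (t (Suc k))) \<le> ?K * \<eta> * (t (Suc k) - l)"
  proof -
    have "norm (of_real D ^ 2 * (p x * q x) / 2) = D * D * (norm (p x) * norm (q x)) / 2"
      using D by (simp add: norm_mult norm_power norm_divide power2_eq_square)
    also have "\<dots> \<le> D * D * (norm (p x) * norm (q x))" using D by simp
    also have "\<dots> \<le> D * \<eta> * (M * M)"
      using D fine M \<eta> bound[OF xlm] by (intro mult_mono) auto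
    finally have quad: "norm (of_real D ^ 2 * (p x * q x) / 2) \<le> M\<^sup>2 * \<eta> * D"
      by (simp add: power2_eq_square mult_ac)
    have "norm (\<beta> - B x) \<le> norm (\<beta> - B (t k)) + norm (B (t k) - B x)"
      using dist_triangle[of \<beta> "B x" "B (t k)"] by (simp add: dist_norm)
    also have "\<dots> \<le> \<eta> * (t k - l) + \<eta>"
      using est(2) local[of B "t k" x] x by (intro add_mono) auto
    also have "\<dots> \<le> \<eta> * (m - l + 1)"
      using mult_left_mono[of "t k - l" "m - l" \<eta>] \<eta> lm x by (simp add: algebra_simps)
    finally have "norm (of_real D * p x * (\<beta> - B x)) \<le> D * M * (\<eta> * (m - l + 1))"
      unfolding norm_mult using D M bound(1)[OF xlm] by (intro mult_mono) auto
    then have cross: "norm (of_real D * p x * (\<beta> - B x)) \<le> M * (m - l + 1) * \<eta> * D"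
      by (simp add: mult_ac)
    \<comment> \<open>Adding and subtracting \<open>D p(x) B(x)\<close> compares the group law, which uses the current \<open>\<beta>\<close>, with
      the differential equation at the tag.\<close>
    have "?\<gamma> - C (t (Suc k)) = (\<gamma> - C (t k))
        - (C (t (Suc k)) - C (t k) - of_real D * (r x + p x * B x))
        + of_real D ^ 2 * (p x * q x) / 2 + of_real D * p x * (\<beta> - B x)"
      by (simp add: algebra_simps)
    also have "norm \<dots> \<le> ?K * \<eta> * (t k - l) + \<eta> * D + M\<^sup>2 * \<eta> * D + M * (m - l + 1) * \<eta> * D"
      by (intro norm_triangle_le[OF add_mono] norm_triangle_le_diff[OF add_mono] est inc quad cross)
    also have "\<dots> = ?K * \<eta> * (t (Suc k) - l)" by (simp add: D_def algebra_simps)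
    finally show ?thesis .
  qed
  ultimately show ?case by blast
qed

text \<open>On a compact interval the coefficients are bounded and uniformly continuous, so the preceding
  estimate applies with any \<open>\<eta> > 0\<close> once the mesh is small, and its constant does not depend on \<open>\<eta>\<close>.\<close>

lemma has_G_integral_normalised:
  fixes p q r A B C :: "real \<Rightarrow> complex"
  assumes "l \<le> m"
    and cont: "continuous_on UNIV p" "continuous_on UNIV q" "continuous_on UNIV r"
    and der: "\<And>s. (A has_vector_derivative p s) (at s)"
      "\<And>s. (B has_vector_derivative q s) (at s)"
      "\<And>s. (C has_vector_derivative r s + p s * B s) (at s)"
    and init: "A l = 0" "B l = 0" "C l = 0"
  shows "has_G_integral (\<lambda>s. mexp (nil3 (p s) (q s) (r s))) (uni3 (A m) (B m) (C m)) l m"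
  unfolding has_G_integral_def
proof (intro conjI allI impI)
  let ?a = "\<lambda>s. mexp (nil3 (p s) (q s) (r s))"
  show "range ?a \<subseteq> grp_G" by (auto simp: mexp_nil3 uni3_in_grp_G)
  show "uni3 (A m) (B m) (C m) \<in> grp_G" by (rule uni3_in_grp_G)
  fix \<epsilon> :: real assume "\<epsilon> > 0"
  have "continuous_on UNIV B"
    using der(2) by (meson continuous_at_imp_continuous_on has_vector_derivative_continuous)
  then have contF: "continuous_on {l..m} f" if "f \<in> {p, q, B, \<lambda>s. r s + p s * B s}" for f
    using that cont by (auto intro!: continuous_intros intro: continuous_on_subset)
  have "\<exists>M. \<forall>s\<in>{l..m}. norm (f s) \<le> M" if "f \<in> {p, q}" for f
    using compact_imp_bounded[OF compact_continuous_image[OF contF compact_Icc], of f] that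
    by (auto simp: bounded_iff)
  then obtain M1 M2 where M12: "\<forall>s\<in>{l..m}. norm (p s) \<le> M1" "\<forall>s\<in>{l..m}. norm (q s) \<le> M2"
    by (metis insertI1 insertI2)
  define M where "M = max M1 M2"
  have bound: "norm (p s) \<le> M" "norm (q s) \<le> M" if "s \<in> {l..m}" for s
    using M12 that by (simp_all add: M_def le_max_iff_disj)
  have M: "0 \<le> M" using order.trans[OF norm_ge_zero bound(1)[of l]] \<open>l \<le> m\<close> by simp
  \<comment> \<open>The sum of the constants for the three entries, \<open>1\<close>, \<open>1\<close> and \<open>1 + M\<^sup>2 + M (m - l + 1)\<close>.\<close>
  define K where "K = 3 + M\<^sup>2 + M * (m - l + 1)"
  have K: "K > 0" unfolding K_def using M \<open>l \<le> m\<close> by (intro add_pos_nonneg) auto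
  \<comment> \<open>The extra \<open>1\<close> keeps the quotient meaningful, and the final estimate strict, when \<open>l = m\<close>.\<close>
  define \<eta> where "\<eta> = \<epsilon> / (K * (m - l + 1))"
  have \<eta>: "\<eta> > 0" unfolding \<eta>_def using \<open>\<epsilon> > 0\<close> K \<open>l \<le> m\<close> by simp
  have "\<exists>\<delta>>0. \<forall>s\<in>{l..m}. \<forall>s'\<in>{l..m}. \<bar>s - s'\<bar> < \<delta> \<longrightarrow> norm (f s - f s') \<le> \<eta>"
    if f: "f \<in> {p, q, B, \<lambda>s. r s + p s * B s}" for f
  proof -
    have "uniformly_continuous_on {l..m} f"
      using contF[OF f] by (rule compact_uniformly_continuous) simp
    from uniformly_continuous_onE[OF this \<eta>] obtain d where
      "d > 0" "\<And>s s'. s \<in> {l..m} \<Longrightarrow> s' \<in> {l..m} \<Longrightarrow> dist s' s < d \<Longrightarrow> dist (f s') (f s) < \<eta>"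
      by blast
    then show ?thesis
      by (intro exI[of _ d]) (auto simp: dist_norm intro!: less_imp_le)
  qed
  then obtain \<delta> where \<delta>: "\<And>f. f \<in> {p, q, B, \<lambda>s. r s + p s * B s} \<Longrightarrow> \<delta> f > 0 \<and>
      (\<forall>s\<in>{l..m}. \<forall>s'\<in>{l..m}. \<bar>s - s'\<bar> < \<delta> f \<longrightarrow> norm (f s - f s') \<le> \<eta>)"
    by metis
  define d where "d = Min (insert \<eta> (\<delta> ` {p, q, B, \<lambda>s. r s + p s * B s}))"
  have "d > 0" unfolding d_def using \<delta> \<eta> by (subst Min_gr_iff) auto
  have d_le: "d \<le> \<eta>" "\<And>f. f \<in> {p, q, B, \<lambda>s. r s + p s * B s} \<Longrightarrow> d \<le> \<delta> f"
    unfolding d_def by (intro Min_le; force)+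
  show "\<exists>\<delta>>0. \<forall>n t \<xi>. tagged_partition l m n t \<xi> \<and> mesh n t < \<delta> \<longrightarrow>
      dist (riemann_product ?a n t \<xi>) (uni3 (A m) (B m) (C m)) < \<epsilon>"
  proof (intro exI[of _ d] conjI allI impI)
    fix n t \<xi> assume *: "tagged_partition l m n t \<xi> \<and> mesh n t < d"
    then have part: "tagged_partition l m n t \<xi>" and fine: "mesh n t < d" by auto
    have tn: "t n = m" using part by (simp add: tagged_partition_def)
    have "norm (f s - f s') \<le> \<eta>"
      if f: "f \<in> {p, q, B, \<lambda>s. r s + p s * B s}" and s: "s \<in> {l..m}" "s' \<in> {l..m}"
        and "\<bar>s - s'\<bar> \<le> mesh n t" for f s s'
    proof -
      have "\<bar>s - s'\<bar> < \<delta> f" using that(4) fine d_le(2)[OF f] by linarith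
      with \<delta>[OF f] s show ?thesis by blast
    qed
    moreover have "mesh n t \<le> \<eta>" using fine d_le(1) by simp
    ultimately obtain \<alpha> \<beta> \<gamma> where prod: "riemann_product ?a n t \<xi> = uni3 \<alpha> \<beta> \<gamma>"
      and est: "norm (\<alpha> - A m) \<le> \<eta> * (m - l)" "norm (\<beta> - B m) \<le> \<eta> * (m - l)"
        "norm (\<gamma> - C m) \<le> (1 + M\<^sup>2 + M * (m - l + 1)) * \<eta> * (m - l)"
      using riemann_product_estimate[OF part order.refl der init bound, of \<eta>] unfolding tn by blast
    have "dist (riemann_product ?a n t \<xi>) (uni3 (A m) (B m) (C m)) \<le> K * \<eta> * (m - l)"
      unfolding prod using dist_uni3_le[of \<alpha> \<beta> \<gamma> "A m" "B m" "C m"] est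
      by (simp add: K_def algebra_simps)
    also have "\<dots> < K * \<eta> * (m - l + 1)" using K \<eta> by simp
    also have "\<dots> = \<epsilon>" using K \<open>l \<le> m\<close> by (simp add: \<eta>_def)
    finally show "dist (riemann_product ?a n t \<xi>) (uni3 (A m) (B m) (C m)) < \<epsilon>" .
  qed (rule \<open>d > 0\<close>)
qed

text \<open>The equation \<open>W' = X W\<close> is invariant under right translation, so \<open>W(s) W(l)\<^sup>-\<^sup>1\<close> is again a solution,
  now starting at the identity.\<close>

lemma has_G_integral_uni3:
  fixes p q r A B C :: "real \<Rightarrow> complex"
  assumes "l \<le> m"
    and cont: "continuous_on UNIV p" "continuous_on UNIV q" "continuous_on UNIV r"
    and der: "\<And>s. (A has_vector_derivative p s) (at s)"
      "\<And>s. (B has_vector_derivative q s) (at s)"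
      "\<And>s. (C has_vector_derivative r s + p s * B s) (at s)"
  shows "has_G_integral (\<lambda>s. mexp (nil3 (p s) (q s) (r s)))
    (uni3 (A m) (B m) (C m) ** matrix_inv (uni3 (A l) (B l) (C l))) l m"
proof -
  have "has_G_integral (\<lambda>s. mexp (nil3 (p s) (q s) (r s)))
    (uni3 (A m - A l) (B m - B l) (C m - C l - (A m - A l) * B l)) l m"
    using assms(1) cont
  proof (rule has_G_integral_normalised)
    show "((\<lambda>s. A s - A l) has_vector_derivative p s) (at s)" for s
      by (auto intro!: derivative_eq_intros der)
    show "((\<lambda>s. B s - B l) has_vector_derivative q s) (at s)" for s
      by (auto intro!: derivative_eq_intros der)
    show "((\<lambda>s. C s - C l - (A s - A l) * B l) has_vector_derivative
        r s + p s * (B s - B l)) (at s)" for s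
      by (rule derivative_eq_intros der refl)+ (simp add: algebra_simps)
  qed simp_all
  moreover have "uni3 (A m) (B m) (C m) ** matrix_inv (uni3 (A l) (B l) (C l)) =
      uni3 (A m - A l) (B m - B l) (C m - C l - (A m - A l) * B l)"
    by (simp add: matrix_inv_uni3 uni3_mult uni3_eq_iff algebra_simps)
  ultimately show ?thesis by simp
qed

text \<open>Since \<open>W(m) W(l)\<^sup>-\<^sup>1\<close> is inverted by exchanging \<open>l\<close> and \<open>m\<close>, the same formula holds for both
  orientations of the interval.\<close>

lemma G_integral_uni3:
  fixes p q r A B C :: "real \<Rightarrow> complex"
  defines "W \<equiv> \<lambda>s. uni3 (A s) (B s) (C s)"
  assumes cont: "continuous_on UNIV p" "continuous_on UNIV q" "continuous_on UNIV r"
    and der: "\<And>s. (A has_vector_derivative p s) (at s)"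
      "\<And>s. (B has_vector_derivative q s) (at s)"
      "\<And>s. (C has_vector_derivative r s + p s * B s) (at s)"
  shows "G_integrable (\<lambda>s. mexp (nil3 (p s) (q s) (r s))) l m"
    and "G_integral l m (\<lambda>s. mexp (nil3 (p s) (q s) (r s))) = W m ** matrix_inv (W l)"
proof -
  let ?a = "\<lambda>s. mexp (nil3 (p s) (q s) (r s))"
  have int: "has_G_integral ?a (W y ** matrix_inv (W x)) x y" if "x \<le> y" for x y
    unfolding W_def using that cont der by (rule has_G_integral_uni3)
  have uniq: "I = W y ** matrix_inv (W x)" if "x \<le> y" "has_G_integral ?a I x y" for I x y
    using that(1,2) int[OF that(1)] by (rule has_G_integral_unique)
  have the: "(THE I. has_G_integral ?a I x y) = W y ** matrix_inv (W x)" if "x \<le> y" for x y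
    using int[OF that] uniq[OF that] by (rule the_equality)
  have mM: "min l m \<le> max l m" by simp
  show "G_integrable ?a l m"
    unfolding G_integrable_def using int[OF mM] uniq[OF mM] by (rule ex1I)
  show "G_integral l m ?a = W m ** matrix_inv (W l)"
  proof (cases "l \<le> m")
    case True
    then show ?thesis by (simp add: G_integral_def the)
  next
    case False
    then have "G_integral l m ?a = matrix_inv (W l ** matrix_inv (W m))"
      by (simp add: G_integral_def the)
    also have "\<dots> = W m ** matrix_inv (W l)"
      by (simp add: W_def matrix_inv_uni3 uni3_mult uni3_eq_iff algebra_simps)
    finally show ?thesis .
  qed
qed

section \<open>The fundamental theorem\<close>

lemma antiderivative_from_zero:
  fixes f :: "real \<Rightarrow> complex"
  assumes "continuous_on UNIV f"
  obtains F where "F 0 = 0" "\<And>s. (F has_vector_derivative f s) (at s)"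
proof -
  have "\<exists>F. \<forall>s. - \<infinity> < ereal s \<longrightarrow> ereal s < \<infinity> \<longrightarrow> (F has_vector_derivative f s) (at s)"
    using assms by (intro einterval_antiderivative) (auto simp: continuous_on_eq_continuous_at)
  then obtain F where "\<And>s. (F has_vector_derivative f s) (at s)" by auto
  then have "((\<lambda>s. F s - F 0) has_vector_derivative f s) (at s)" for s
    by (auto intro!: derivative_eq_intros)
  then show ?thesis using that[of "\<lambda>s. F s - F 0"] by simp
qed

text \<open>Solving \<open>W' = X W\<close> with \<open>W(0) = 1\<close> identifies the indefinite integral with the solution \<open>W\<close>,
  whose derivative is known.\<close>

lemma G_deriv_G_integral:
  fixes p q r :: "real \<Rightarrow> complex"
  defines "a \<equiv> \<lambda>s. mexp (nil3 (p s) (q s) (r s))"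
  assumes cont: "continuous_on UNIV p" "continuous_on UNIV q" "continuous_on UNIV r"
  shows "G_integrable a 0 x"
    and "G_differentiable (\<lambda>y. G_integral 0 y a) x"
    and "G_deriv (\<lambda>y. G_integral 0 y a) x = a x"
proof -
  obtain A where A: "A 0 = 0" "\<And>s. (A has_vector_derivative p s) (at s)"
    using antiderivative_from_zero[OF cont(1)] by blast
  obtain B where B: "B 0 = 0" "\<And>s. (B has_vector_derivative q s) (at s)"
    using antiderivative_from_zero[OF cont(2)] by blast
  have "continuous_on UNIV B"
    using B(2) by (meson continuous_at_imp_continuous_on has_vector_derivative_continuous)
  then have "continuous_on UNIV (\<lambda>s. r s + p s * B s)"
    by (intro continuous_intros cont)
  then obtain C where C: "C 0 = 0" "\<And>s. (C has_vector_derivative r s + p s * B s) (at s)"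
    using antiderivative_from_zero by blast
  note int = G_integral_uni3[OF cont A(2) B(2) C(2), folded a_def]
  show "G_integrable a 0 x" by (rule int(1))
  have "(\<lambda>y. G_integral 0 y a) = (\<lambda>y. uni3 (A y) (B y) (C y))"
    unfolding int(2) by (simp add: A(1) B(1) C(1) matrix_inv_uni3 uni3_mult)
  then have "has_G_derivative (\<lambda>y. G_integral 0 y a) (a x) x"
    using has_G_derivative_uni3[OF A(2) B(2) C(2)] by (simp add: a_def)
  then show "G_differentiable (\<lambda>y. G_integral 0 y a) x"
    and "G_deriv (\<lambda>y. G_integral 0 y a) x = a x"
    by (rule has_G_derivativeD)+
qed

text \<open>Smoothness enters through the continuity of \<open>p'\<close>, \<open>q'\<close> and \<open>r'\<close>, which makes the logarithmic
  derivative of \<open>mexp u\<close> continuous and hence its exponential integrable.\<close>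

lemma space_J_coordinates:
  assumes "u \<in> space_J"
  obtains p q r p' q' r' where "\<And>s. u s = nil3 (p s) (q s) (r s)"
    and "\<And>s. (p has_vector_derivative p' s) (at s)"
      "\<And>s. (q has_vector_derivative q' s) (at s)"
      "\<And>s. (r has_vector_derivative r' s) (at s)"
    and "continuous_on UNIV p'" "continuous_on UNIV q'" "continuous_on UNIV r'"
proof -
  define u' where "u' s = vector_derivative u (at s)" for s
  have smooth: "((\<lambda>f s. vector_derivative f (at s)) ^^ n) u differentiable at t" for n t
    using assms unfolding space_J_def smooth_curve_def by blast
  have u': "(u has_vector_derivative u' s) (at s)" for s
    using smooth[of 0 s] by (simp add: u'_def flip: vector_derivative_works)
  have "u' differentiable at s" for s
    using smooth[of 1 s] by (simp add: u'_def[abs_def])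
  then have cont: "continuous_on UNIV u'"
    by (simp add: continuous_at_imp_continuous_on differentiable_imp_continuous_within)
  have entry: "bounded_linear (\<lambda>X::cmat3. X $ i $ j)" for i j
    using bounded_linear_compose[OF bounded_linear_vec_nth bounded_linear_vec_nth] .
  show ?thesis
  proof (rule that)
    show "u s = nil3 (u s $ 1 $ 2) (u s $ 2 $ 3) (u s $ 1 $ 3)" for s
    proof -
      have "u s \<in> lie_g" using assms by (auto simp: space_J_def)
      then show ?thesis by (auto simp: lie_g_eq nil3_def)
    qed
  qed (use bounded_linear.has_vector_derivative[OF entry u'] bounded_linear.continuous_on[OF entry cont]
      in blast)+
qed

theorem proposition3p27:
  fixes u :: "real \<Rightarrow> cmat3"
  assumes "u \<in> space_J"
  shows "(\<forall>x. G_integrable (\<lambda>t. mexp (u t)) 0 x)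
    \<and> (\<forall>x. G_differentiable (\<lambda>y. G_integral 0 y (\<lambda>t. mexp (u t))) x)
    \<and> (\<forall>x. G_differentiable (\<lambda>t. mexp (u t)) x)
    \<and> (\<forall>x. G_integrable (G_deriv (\<lambda>t. mexp (u t))) 0 x)
    \<and> (\<forall>x. G_deriv (\<lambda>y. G_integral 0 y (\<lambda>t. mexp (u t))) x = mexp (u x))
    \<and> (\<forall>x. G_integral 0 x (G_deriv (\<lambda>t. mexp (u t)))
            = mexp (u x) ** matrix_inv (mexp (u 0)))
    \<and> (u 0 = 0 \<longrightarrow>
        (\<forall>x. G_deriv (\<lambda>y. G_integral 0 y (\<lambda>t. mexp (u t))) x
               = G_integral 0 x (G_deriv (\<lambda>t. mexp (u t)))
           \<and> G_integral 0 x (G_deriv (\<lambda>t. mexp (u t))) = mexp (u x)))"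
proof -
  obtain p q r p' q' r' where u: "\<And>s. u s = nil3 (p s) (q s) (r s)"
    and der: "\<And>s. (p has_vector_derivative p' s) (at s)"
      "\<And>s. (q has_vector_derivative q' s) (at s)"
      "\<And>s. (r has_vector_derivative r' s) (at s)"
    and cont': "continuous_on UNIV p'" "continuous_on UNIV q'" "continuous_on UNIV r'"
    using space_J_coordinates[OF assms] by blast
  have cont: "continuous_on UNIV p" "continuous_on UNIV q" "continuous_on UNIV r"
    using der by (meson continuous_at_imp_continuous_on has_vector_derivative_continuous)+
  let ?a = "\<lambda>t. mexp (u t)"
  \<comment> \<open>The corner entry of the logarithmic derivative of \<open>mexp u\<close>: the derivative of \<open>r + p q / 2\<close>
    minus \<open>p' q\<close>.\<close>
  define z where "z s = r' s + (p s * q' s - p' s * q s) / 2" for s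
  have cont_z: "continuous_on UNIV z"
    unfolding z_def by (intro continuous_intros cont cont') simp
  have der_c: "((\<lambda>s. r s + p s * q s / 2) has_vector_derivative z s + p' s * q s) (at s)" for s
    by (rule derivative_eq_intros der refl)+ (simp add: z_def field_simps)
  have a: "?a = (\<lambda>s. uni3 (p s) (q s) (r s + p s * q s / 2))"
    by (simp add: u mexp_nil3)
  have deriv: "has_G_derivative ?a (mexp (nil3 (p' s) (q' s) (z s))) s" for s
    unfolding a by (intro has_G_derivative_uni3 der der_c)
  have deriv_eq: "G_deriv ?a = (\<lambda>s. mexp (nil3 (p' s) (q' s) (z s)))"
    using has_G_derivativeD(2)[OF deriv] by blast
  note first = G_deriv_G_integral[OF cont, folded u]
  note second = G_integral_uni3[OF cont'(1,2) cont_z der(1,2) der_c, folded deriv_eq a]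
  have second_eq: "G_integral 0 x (G_deriv ?a) = ?a x ** matrix_inv (?a 0)" for x
    unfolding second(2) by (simp add: u mexp_nil3)
  have "?a x ** matrix_inv (?a 0) = ?a x" if "u 0 = 0" for x
  proof -
    have "nil3 (p 0) (q 0) (r 0) = 0" using that u by simp
    then have "p 0 = 0" "q 0 = 0" "r 0 = 0" by (simp_all add: nil3_def vec_eq_iff forall_3)
    then show ?thesis by (simp add: u mexp_nil3 matrix_inv_uni3 uni3_mult)
  qed
  then show ?thesis
    using first second(1) second_eq has_G_derivativeD(1)[OF deriv] by simp
qed

end
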